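(* Let $n\ge 0$ and let $0\le\mu\le\nu\le n$ be integers. The complementary polynomials satisfy the Rodrigues functional formulas $$\mathscr{P}_{\nu}(x;n)\,\mathbf{u}_{n-\nu}=\frac{d^{\nu}}{dx^{\nu}}[\mathbf{u}_n],\qquad\text{equivalently}\qquad \mathscr{P}_{\nu}(x;n)=\mathscr{R}_{\nu,n-\nu}[1],$$ and $$\mathscr{P}_{\nu}(x;n)\,\mathbf{u}_{n-\nu}=\frac{d^{\nu-\mu}}{dx^{\nu-\mu}}[\mathscr{P}_{\mu}(x;n)\,\mathbf{u}_{n-\mu}],\qquad\text{equivalently}\qquad \mathscr{P}_{\nu}(x;n)=\big(\mathscr{R}_{\nu-\mu,n-\nu}\circ\mathscr{R}_{\mu,n-\mu}\big)[1].$$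
   Context: Let $\mathbb{P}=\mathbb{C}[x]$ and let $\mathbb{P}'$ be its algebraic dual (the linear functionals on $\mathbb{P}$). For $\mathbf{v}\in\mathbb{P}'$ and $Q\in\mathbb{P}$, define $Q\mathbf{v}$ and $\frac{d}{dx}\mathbf{v}=\mathbf{v}'$ in $\mathbb{P}'$ by $\langle Q\mathbf{v},P\rangle=\langle\mathbf{v},QP\rangle$ and $\langle\mathbf{v}',P\rangle=-\langle\mathbf{v},P'\rangle$ for $P\in\mathbb{P}$. Standing assumptions. $\phi,\psi\in\mathbb{P}$ with $\deg\phi\le 2$, $\deg\psi\le 1$. $\mathbf{u}\in\mathbb{P}'$ satisfies $\frac{d}{dx}[\phi\mathbf{u}]=\psi\mathbf{u}$. $\mathbf{u}$ is quasi-definite (regular): there are polynomials $P_n$ with $\deg P_n=n$ ($n\ge 0$) such that $\langle\mathbf{u},P_nP_m\rangle=r_n\delta_{n,m}$ with $r_n\neq 0$. The $P_n$ are solutions of $\phi P_n''+\psi P_n'+\lambda_nP_n=0$ with $\lambda_n=-n\psi'-\frac n2(n-1)\phi''$. Put $\mathbf{u}_0=\mathbf{u}$, $\mathbf{u}_k=\phi\,\mathbf{u}_{k-1}$ for $k\ge1$. The Rodrigues functional formula holds: $P_n\mathbf{u}=B_n\frac{d^n}{dx^n}[\mathbf{u}_n]$ with constants $B_n\neq0$. Rodrigues operator. For a pair $(\phi,\mathbf{v})$ for which there is a polynomial $\chi$ with $\frac{d}{dx}[\phi\mathbf{v}]=\chi\mathbf{v}$, put $\mathbf{v}_1=\phi\mathbf{v}$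 and define operators on $\mathbb{P}$ by: $R_0(\phi,\mathbf{v})=I$ (the identity); $R_1(\phi,\mathbf{v})[p]=q$ where $q$ is the polynomial with $\frac{d}{dx}[p\,\mathbf{v}_1]=q\,\mathbf{v}$; $R_k(\phi,\mathbf{v})=R_1(\phi,\mathbf{v})\circ R_{k-1}(\phi,\mathbf{v}_1)$ for $k\ge 2$. Write $\mathscr{R}_{k,\ell}=R_k(\phi,\mathbf{u}_\ell)$. Complementary polynomials. For integers $0\le\nu\le n$, the complementary polynomial $\mathscr{P}_\nu(x;n)$ with respect to $P_n$ is the polynomial determined by $P_n(x)=B_n\,R_{n-\nu}(\phi,\mathbf{u})[\mathscr{P}_\nu(x;n)]$, where $B_n$ is the constant of the Rodrigues functional formula. *)

theory Defs
  imports Complex_Main "HOL-Computational_Algebra.Polynomial"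
begin

text \<open>
  An element of the algebraic dual of \<open>\<complex>[x]\<close> is a function \<open>v\<close> of the type below that satisfies
  \<open>Vector_Spaces.linear smult (*) v\<close>. All operations defined here preserve linearity, so linearity
  has to be assumed of the initial functional only.
\<close>

type_synonym pfunctional = "complex poly \<Rightarrow> complex"

definition fmult :: "complex poly \<Rightarrow> pfunctional \<Rightarrow> pfunctional" where
  "fmult Q v = (\<lambda>P. v (Q * P))"

definition fderiv :: "pfunctional \<Rightarrow> pfunctional" where
  "fderiv v = (\<lambda>P. - v (pderiv P))"

definition fscale :: "complex \<Rightarrow> pfunctional \<Rightarrow> pfunctional" where
  "fscale c v = (\<lambda>P. c * v P)"

text \<open>The functionals \<open>u\<^sub>0 = u\<close>, \<open>u\<^sub>k = \<phi> u\<^sub>k\<^sub>-\<^sub>1\<close>.\<close>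

primrec fseq :: "complex poly \<Rightarrow> pfunctional \<Rightarrow> nat \<Rightarrow> pfunctional" where
  "fseq \<phi> u 0 = u"
| "fseq \<phi> u (Suc k) = fmult \<phi> (fseq \<phi> u k)"

text \<open>
  The description below is meaningful when \<open>fderiv (fmult \<phi> v) = fmult \<chi> v\<close> for some polynomial
  \<open>\<chi>\<close> (then \<open>q = \<phi> p' + \<chi> p\<close> exists) and \<open>fmult Q v = 0\<close> only for \<open>Q = 0\<close> (then \<open>q\<close> is unique).
  Both hold for every \<open>v = fseq \<phi> u \<ell>\<close> when \<open>u\<close> is quasi-definite, \<open>\<phi> \<noteq> 0\<close> and
  \<open>fderiv (fmult \<phi> u) = fmult \<psi> u\<close>, with \<open>\<chi> = \<psi> + \<ell> \<phi>'\<close>.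
\<close>

definition rodrigues1 :: "complex poly \<Rightarrow> pfunctional \<Rightarrow> complex poly \<Rightarrow> complex poly" where
  "rodrigues1 \<phi> v p = (THE q. fderiv (fmult p (fmult \<phi> v)) = fmult q v)"

text \<open>The order \<open>k\<close> comes before \<open>v\<close>: \<open>rodrigues \<phi> k v\<close> is \<open>R\<^sub>k(\<phi>, v)\<close>.\<close>

primrec rodrigues ::
    "complex poly \<Rightarrow> nat \<Rightarrow> pfunctional \<Rightarrow> complex poly \<Rightarrow> complex poly" where
  "rodrigues \<phi> 0 v = id"
| "rodrigues \<phi> (Suc k) v = rodrigues1 \<phi> v \<circ> rodrigues \<phi> k (fmult \<phi> v)"

definition rodrigues_at ::
    "complex poly \<Rightarrow> pfunctional \<Rightarrow> nat \<Rightarrow> nat \<Rightarrow> complex poly \<Rightarrow> complex poly" where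
  "rodrigues_at \<phi> u k l = rodrigues \<phi> k (fseq \<phi> u l)"

definition complementary_poly ::
    "complex poly \<Rightarrow> pfunctional \<Rightarrow> (nat \<Rightarrow> complex poly) \<Rightarrow> (nat \<Rightarrow> complex) \<Rightarrow>
     nat \<Rightarrow> nat \<Rightarrow> complex poly" where
  "complementary_poly \<phi> u P B \<nu> n =
     (THE p. P n = smult (B n) (rodrigues \<phi> (n - \<nu>) u p))"

end

theory Submission
  imports Defs
begin

text \<open>
  Taking \<open>R\<^sub>k(\<phi>, v)\<close> of \<open>p\<close> amounts to differentiating functionals: its value \<open>q\<close> is the polynomial
  with \<open>q v = D\<^sup>k (p v\<^sub>k)\<close>, where \<open>v\<^sub>k = \<phi>\<^sup>k v\<close> (lemma \<open>fmult_rodrigues\<close>). Such a \<open>q\<close> exists because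
  \<open>D (p \<phi> v) = (\<phi> p' + \<chi> p) v\<close> as soon as \<open>D (\<phi> v) = \<chi> v\<close>, and the latter equation is inherited by
  \<open>\<phi> v\<close>, with \<open>\<chi> + \<phi>'\<close> in place of \<open>\<chi>\<close>. It is unique because \<open>u\<close> is quasi-definite, so that
  \<open>Q \<mapsto> Q u\<close> is injective, and this too is inherited by \<open>\<phi> u\<close>, since \<open>\<phi> \<noteq> 0\<close>.

  Two consequences give the theorem. First, \<open>R\<^sub>k(\<phi>, v)\<close> is injective: every polynomial is a
  derivative, so \<open>D\<close> is injective on functionals, and \<open>p \<mapsto> p v\<^sub>k\<close> is injective. Secondly,
  the definition of \<open>R\<close> unrolls to \<open>R\<^sub>j\<^sub>+\<^sub>k(\<phi>, v) = R\<^sub>j(\<phi>, v) \<circ> R\<^sub>k(\<phi>, v\<^sub>j)\<close>. The Rodrigues functional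
  formula says \<open>P\<^sub>n = B\<^sub>n R\<^sub>n(\<phi>, u)[1] = B\<^sub>n R\<^sub>n\<^sub>-\<^sub>\<nu>(\<phi>, u)[R\<^sub>\<nu>(\<phi>, u\<^sub>n\<^sub>-\<^sub>\<nu>)[1]]\<close>, and injectivity identifies
  \<open>R\<^sub>\<nu>(\<phi>, u\<^sub>n\<^sub>-\<^sub>\<nu>)[1]\<close> as the complementary polynomial. Both displayed functional identities are then
  instances of \<open>fmult_rodrigues\<close>, and the last formula is the unrolling of \<open>R\<close> once more.
\<close>

section \<open>Functionals on polynomials\<close>

lemma fmult_one: "fmult 1 v = v"
  by (simp add: fmult_def)

lemma fmult_fmult: "fmult Q (fmult R v) = fmult (Q * R) v"
  by (simp add: fmult_def mult_ac)

lemma fseq_fmult: "fseq \<phi> (fmult \<phi> v) k = fseq \<phi> v (Suc k)"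
  by (induction k) simp_all

lemma fseq_add: "fseq \<phi> (fseq \<phi> v j) k = fseq \<phi> v (k + j)"
  by (induction k) simp_all

lemma ex_antiderivative:
  fixes q :: "'a::field_char_0 poly"
  shows "\<exists>p. pderiv p = q"
proof
  have "pderiv (\<Sum>i\<le>degree q. monom (coeff q i / of_nat (Suc i)) (Suc i))
      = (\<Sum>i\<le>degree q. monom (coeff q i) i)"
    unfolding higher_pderiv_sum[of 1, simplified]
    by (intro sum.cong refl) (simp add: pderiv_monom del: of_nat_Suc)
  then show "pderiv (\<Sum>i\<le>degree q. monom (coeff q i / of_nat (Suc i)) (Suc i)) = q"
    by (simp add: poly_as_sum_of_monoms)
qed

text \<open>A functional is determined by its values on derivatives, since these are all polynomials.\<close>

lemma inj_fderiv: "inj fderiv"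
proof (rule injI, rule ext)
  fix v w :: pfunctional and q :: "complex poly"
  assume "fderiv v = fderiv w"
  then have "v (pderiv p) = w (pderiv p)" for p
    unfolding fderiv_def by (metis neg_equal_iff_equal)
  moreover obtain p where "q = pderiv p"
    using ex_antiderivative by metis
  ultimately show "v q = w q"
    by simp
qed

section \<open>Quasi-definite functionals\<close>

lemma graded_poly_expansion:
  fixes P :: "nat \<Rightarrow> 'a::field poly"
  assumes deg_P: "\<And>k. degree (P k) = k" and nz: "\<And>k. P k \<noteq> 0"
  shows "(\<And>i. N \<le> i \<Longrightarrow> coeff q i = 0) \<Longrightarrow> \<exists>c. q = (\<Sum>k<N. smult (c k) (P k))"
proof (induction N arbitrary: q)
  case 0
  then show ?case
    by (simp add: poly_eq_iff)
next
  case (Suc N)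
  define a where "a = coeff q N / coeff (P N) N"
  have "coeff (P N) N \<noteq> 0"
    using deg_P nz by (metis leading_coeff_0_iff)
  then have "coeff (q - smult a (P N)) i = 0" if "N \<le> i" for i
    using that Suc.prems[of i] deg_P coeff_eq_0[of "P N" i]
    by (cases "i = N") (auto simp: a_def)
  then obtain c where c: "q - smult a (P N) = (\<Sum>k<N. smult (c k) (P k))"
    using Suc.IH by blast
  have "q = (\<Sum>k<Suc N. smult ((c(N := a)) k) (P k))"
    using c by (simp add: algebra_simps)
  then show ?case
    by (rule exI[of _ "c(N := a)"])
qed

text \<open>
  The coefficients in the expansion of \<open>q\<close> along the orthogonal polynomials are
  \<open>\<langle>u, q P\<^sub>m\<rangle> / r\<^sub>m\<close>, so the functional \<open>q u\<close> determines \<open>q\<close>.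
\<close>

lemma quasi_definite_imp_faithful:
  assumes lin: "Vector_Spaces.linear smult (*) u"
    and deg_P: "\<And>k. degree (P k) = k"
    and orthogonal: "\<And>k m. u (P k * P m) = (if k = m then r k else 0)"
    and r_nonzero: "\<And>k. r k \<noteq> 0"
    and eq: "fmult p u = fmult q u"
  shows "p = q"
proof -
  interpret u: Vector_Spaces.linear smult "(*)" u
    by (fact lin)
  have nz: "P k \<noteq> 0" for k
    using orthogonal[of k k] r_nonzero[of k] u.zero by auto
  have "coeff (p - q) i = 0" if "Suc (degree (p - q)) \<le> i" for i
    using that by (intro coeff_eq_0) simp
  then obtain c where c: "p - q = (\<Sum>k<Suc (degree (p - q)). smult (c k) (P k))"
    using graded_poly_expansion[OF deg_P nz] by blast
  have "c m = 0" if "m < Suc (degree (p - q))" for m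
  proof -
    have "0 = u ((p - q) * P m)"
      using eq by (simp add: fmult_def fun_eq_iff left_diff_distrib u.diff)
    also have "\<dots> = u (\<Sum>k<Suc (degree (p - q)). smult (c k) (P k * P m))"
      by (subst c) (simp only: sum_distrib_right mult_smult_left)
    also have "\<dots> = (\<Sum>k<Suc (degree (p - q)). c k * u (P k * P m))"
      by (simp only: u.sum u.scale)
    also have "\<dots> = (\<Sum>k<Suc (degree (p - q)). if k = m then c m * r m else 0)"
      by (intro sum.cong refl) (simp add: orthogonal)
    also have "\<dots> = c m * r m"
      using that by (simp del: sum.lessThan_Suc)
    finally show "c m = 0"
      using r_nonzero by simp
  qed
  then have "p - q = 0"
    by (subst c) (simp del: sum.lessThan_Suc)
  then show ?thesis
    by simp
qed

section \<open>Rodrigues operators\<close>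

text \<open>
  The conditions on \<open>(\<phi>, v)\<close> under which the operators \<open>R\<^sub>k(\<phi>, v)\<close> are well defined for all \<open>k\<close>
  and injective.
\<close>

locale rodrigues_pair =
  fixes \<phi> :: "complex poly" and v :: pfunctional
  assumes nonzero: "\<phi> \<noteq> 0"
    and add: "v (p + q) = v p + v q"
    and faithful: "fmult p v = fmult q v \<Longrightarrow> p = q"
    and pearson: "\<exists>\<chi>. fderiv (fmult \<phi> v) = fmult \<chi> v"
begin

lemma fderiv_fmult:
  assumes "fderiv (fmult \<phi> v) = fmult \<chi> v"
  shows "fderiv (fmult p (fmult \<phi> v)) = fmult (\<phi> * pderiv p + \<chi> * p) v"
proof
  fix f
  have *: "v (\<chi> * (p * f)) = - v (\<phi> * pderiv (p * f))"
    using fun_cong[OF assms, of "p * f"] by (simp add: fderiv_def fmult_def)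
  show "fderiv (fmult p (fmult \<phi> v)) f = fmult (\<phi> * pderiv p + \<chi> * p) v f"
    using * by (simp add: fderiv_def fmult_def pderiv_mult add ring_distribs mult_ac)
qed

lemma fmult_rodrigues1:
  "fmult (rodrigues1 \<phi> v p) v = fderiv (fmult p (fmult \<phi> v))"
proof -
  obtain q where "fderiv (fmult p (fmult \<phi> v)) = fmult q v"
    using pearson fderiv_fmult by blast
  then have "\<exists>!q. fderiv (fmult p (fmult \<phi> v)) = fmult q v"
    using faithful by metis
  from theI'[OF this] show ?thesis
    by (simp add: rodrigues1_def)
qed

lemma rodrigues_pair_fmult: "rodrigues_pair \<phi> (fmult \<phi> v)"
proof
  show "\<phi> \<noteq> 0"
    by (fact nonzero)
  show "fmult \<phi> v (p + q) = fmult \<phi> v p + fmult \<phi> v q" for p q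
    by (simp add: fmult_def ring_distribs add)
  show "p = q" if "fmult p (fmult \<phi> v) = fmult q (fmult \<phi> v)" for p q
    using faithful[of "p * \<phi>" "q * \<phi>"] that nonzero by (simp add: fmult_fmult)
  obtain \<chi> where "fderiv (fmult \<phi> v) = fmult \<chi> v"
    using pearson by blast
  \<comment> \<open>In \<open>D (\<phi> \<phi> v) = (\<phi> \<phi>' + \<chi> \<phi>) v\<close> a factor \<open>\<phi>\<close> can be moved into the functional.\<close>
  then have "fderiv (fmult \<phi> (fmult \<phi> v)) = fmult (pderiv \<phi> + \<chi>) (fmult \<phi> v)"
    using fderiv_fmult[of \<chi> \<phi>] by (simp add: fmult_fmult algebra_simps)
  then show "\<exists>\<chi>. fderiv (fmult \<phi> (fmult \<phi> v)) = fmult \<chi> (fmult \<phi> v)" ..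
qed

end

lemma rodrigues_pair_fseq:
  assumes "rodrigues_pair \<phi> v"
  shows "rodrigues_pair \<phi> (fseq \<phi> v k)"
  using assms by (induction k) (auto intro: rodrigues_pair.rodrigues_pair_fmult)

text \<open>Each factor \<open>R\<^sub>1\<close> trades one factor \<open>\<phi>\<close> of the functional for one derivative.\<close>

lemma fmult_rodrigues:
  assumes "rodrigues_pair \<phi> v"
  shows "fmult (rodrigues \<phi> k v p) v = (fderiv ^^ k) (fmult p (fseq \<phi> v k))"
  using assms
proof (induction k arbitrary: v)
  case 0
  then show ?case
    by simp
next
  case (Suc k)
  then interpret rodrigues_pair \<phi> v
    by simp
  show ?case
    using Suc.IH[OF rodrigues_pair_fmult]
    by (simp add: fmult_rodrigues1 fseq_fmult)
qed

lemma inj_rodrigues: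
  assumes "rodrigues_pair \<phi> v"
  shows "inj (rodrigues \<phi> k v)"
proof (rule injI)
  fix p q
  assume "rodrigues \<phi> k v p = rodrigues \<phi> k v q"
  then have "(fderiv ^^ k) (fmult p (fseq \<phi> v k)) = (fderiv ^^ k) (fmult q (fseq \<phi> v k))"
    using fmult_rodrigues[OF assms] by metis
  then have "fmult p (fseq \<phi> v k) = fmult q (fseq \<phi> v k)"
    using inj_fn[OF inj_fderiv] by (simp add: inj_eq)
  then show "p = q"
    using rodrigues_pair.faithful[OF rodrigues_pair_fseq[OF assms]] by blast
qed

lemma rodrigues_add:
  "rodrigues \<phi> (j + k) v = rodrigues \<phi> j v \<circ> rodrigues \<phi> k (fseq \<phi> v j)"
  by (induction j arbitrary: v) (simp_all add: fseq_fmult comp_assoc)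

section \<open>Complementary polynomials\<close>

theorem theorem3p1:
  fixes \<phi> \<psi> :: "complex poly"
    and u :: pfunctional
    and P :: "nat \<Rightarrow> complex poly"
    and r B :: "nat \<Rightarrow> complex"
    and n \<mu> \<nu> :: nat
  assumes deg_phi: "degree \<phi> \<le> 2"
    and deg_psi: "degree \<psi> \<le> 1"
    and linear_u: "Vector_Spaces.linear smult (*) u"
    and pearson: "fderiv (fmult \<phi> u) = fmult \<psi> u"
    and deg_P: "\<And>k. degree (P k) = k"
    and orthogonal: "\<And>k m. u (P k * P m) = (if k = m then r k else 0)"
    and r_nonzero: "\<And>k. r k \<noteq> 0"
    and ode: "\<And>k. \<phi> * pderiv (pderiv (P k)) + \<psi> * pderiv (P k)
        + (- smult (of_nat k) (pderiv \<psi>)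
           - smult (of_nat k / 2 * (of_nat k - 1)) (pderiv (pderiv \<phi>))) * P k = 0"
    and B_nonzero: "\<And>k. B k \<noteq> 0"
    and rodrigues_formula:
      "\<And>k. fmult (P k) u = fscale (B k) ((fderiv ^^ k) (fseq \<phi> u k))"
    and mu_le_nu: "\<mu> \<le> \<nu>"
    and nu_le_n: "\<nu> \<le> n"
  shows "fmult (complementary_poly \<phi> u P B \<nu> n) (fseq \<phi> u (n - \<nu>))
           = (fderiv ^^ \<nu>) (fseq \<phi> u n)
       \<and> complementary_poly \<phi> u P B \<nu> n = rodrigues_at \<phi> u \<nu> (n - \<nu>) 1
       \<and> fmult (complementary_poly \<phi> u P B \<nu> n) (fseq \<phi> u (n - \<nu>))
           = (fderiv ^^ (\<nu> - \<mu>))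
               (fmult (complementary_poly \<phi> u P B \<mu> n) (fseq \<phi> u (n - \<mu>)))
       \<and> complementary_poly \<phi> u P B \<nu> n
           = (rodrigues_at \<phi> u (\<nu> - \<mu>) (n - \<nu>) \<circ> rodrigues_at \<phi> u \<mu> (n - \<mu>)) 1"
proof -
  interpret u: Vector_Spaces.linear smult "(*)" u
    by (fact linear_u)
  have faithful: "p = q" if "fmult p u = fmult q u" for p q
    using quasi_definite_imp_faithful[OF linear_u deg_P orthogonal r_nonzero that] .
  \<comment> \<open>If \<open>\<phi>\<close> vanished, the Rodrigues formula for \<open>k = 1\<close> would give \<open>P\<^sub>1 u = 0\<close>.\<close>
  have "\<phi> \<noteq> 0"
  proof
    assume "\<phi> = 0"
    then have "fmult (P 1) u = fmult 0 u"
      using rodrigues_formula[of 1]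
      by (simp add: fmult_def fderiv_def fscale_def u.zero fun_eq_iff)
    then show False
      using faithful deg_P[of 1] by force
  qed
  then have pair: "rodrigues_pair \<phi> u"
    using faithful pearson by unfold_locales (auto simp: u.add)
  have complementary: "complementary_poly \<phi> u P B \<kappa> n = rodrigues_at \<phi> u \<kappa> (n - \<kappa>) 1"
    if "\<kappa> \<le> n" for \<kappa>
  proof -
    have "fmult (P n) u = fscale (B n) (fmult (rodrigues \<phi> n u 1) u)"
      by (simp add: rodrigues_formula fmult_rodrigues[OF pair] fmult_one)
    also have "\<dots> = fmult (smult (B n) (rodrigues \<phi> n u 1)) u"
      by (simp add: fscale_def fmult_def u.scale)
    finally have "P n = smult (B n) (rodrigues \<phi> n u 1)"
      by (rule faithful)
    then have P_n: "P n = smult (B n) (rodrigues \<phi> (n - \<kappa>) u (rodrigues_at \<phi> u \<kappa> (n - \<kappa>) 1))"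
      using rodrigues_add[of \<phi> "n - \<kappa>" \<kappa> u] that by (simp add: rodrigues_at_def)
    show ?thesis
      unfolding complementary_poly_def
    proof (rule the_equality)
      fix p
      assume "P n = smult (B n) (rodrigues \<phi> (n - \<kappa>) u p)"
      then have "smult (B n) (rodrigues \<phi> (n - \<kappa>) u p)
          = smult (B n) (rodrigues \<phi> (n - \<kappa>) u (rodrigues_at \<phi> u \<kappa> (n - \<kappa>) 1))"
        using P_n by (rule trans[OF sym])
      then show "p = rodrigues_at \<phi> u \<kappa> (n - \<kappa>) 1"
        using B_nonzero[of n] inj_rodrigues[OF pair] by (simp add: inj_eq)
    qed (fact P_n)
  qed
  have derivative: "fmult (complementary_poly \<phi> u P B \<kappa> n) (fseq \<phi> u (n - \<kappa>))
      = (fderiv ^^ \<kappa>) (fseq \<phi> u n)" if "\<kappa> \<le> n" for \<kappa>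
    using fmult_rodrigues[OF rodrigues_pair_fseq[OF pair]] that
    by (simp add: complementary rodrigues_at_def fmult_one fseq_add)
  have mu_le_n: "\<mu> \<le> n"
    using mu_le_nu nu_le_n by simp
  have "(fderiv ^^ \<nu>) (fseq \<phi> u n) = (fderiv ^^ (\<nu> - \<mu>)) ((fderiv ^^ \<mu>) (fseq \<phi> u n))"
    using funpow_add[of "\<nu> - \<mu>" \<mu> fderiv] mu_le_nu by simp
  moreover have "rodrigues_at \<phi> u \<nu> (n - \<nu>)
      = rodrigues_at \<phi> u (\<nu> - \<mu>) (n - \<nu>) \<circ> rodrigues_at \<phi> u \<mu> (n - \<mu>)"
    using rodrigues_add[of \<phi> "\<nu> - \<mu>" \<mu> "fseq \<phi> u (n - \<nu>)"] mu_le_nu nu_le_n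
    by (simp add: rodrigues_at_def fseq_add)
  ultimately show ?thesis
    using complementary[OF nu_le_n] derivative[OF nu_le_n] derivative[OF mu_le_n] by simp
qed

end
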